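(* Let $x_1,\dots,x_6\in\mathbb{P}^2_x$ and $y_1,\dots,y_6\in\mathbb{P}^2_y$ be in general position (in their respective projective planes), and let $S_x$ (respectively $S_y$) be the blow up of $\mathbb{P}^2_x$ (respectively $\mathbb{P}^2_y$) at $x_1,\dots,x_6$ (respectively $y_1,\dots,y_6$) in Cremona hexahedral form. Let $Z_6$ be the $6\times 9$ matrix with rows $x_i^\top\otimes y_i^\top$. Then $S_x=S_y$ if and only if either there exists a homography $H$ such that $Hx_i=y_i$ for all $i=1,\dots,6$ or the matrix $Z_6$ is rank deficient (i.e. $\operatorname{rank}(Z_6)<6$).
   Context: $\mathbb{P}^n$ is projective space over $\mathbb{C}$; $\mathbb{P}^2_x,\mathbb{P}^2_y$ are two copies of $\mathbb{P}^2$. Points are represented by nonzero column vectors; $\otimes$ is the Kronecker product. A homography is an element of $\mathrm{PGL}(3)$. Six points in $\mathbb{P}^2$ are in general position if at most $2$ of them are in a line and at most $5$ of them are on a conic. For $p_1,\dots,p_6\in\mathbb{P}^2$ and $u=(u_0,u_1,u_2)$, let $[iju]$ be the determinant of the $3\times3$ matrix with rows $p_i^\top,p_j^\top,u^\top$, and define the cubics $$\begin{aligned} a(u)&=[25u][13u][46u]+[51u][42u][36u]+[14u][35u][26u]+[43u][21u][56u]+[32u][54u][16u]\\ b(u)&=[53u][12u][46u]+[14u][23u][56u]+[25u][34u][16u]+[31u][45u][26u]+[42u][51u][36u]\\ c(u)&=[53u][41u][26u]+[34u][25u][16u]+[42u][13u][56u]+[21u][54u][36u]+[15u][32u][46u]\\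 d(u)&=[45u][31u][26u]+[53u][24u][16u]+[41u][25u][36u]+[32u][15u][46u]+[21u][43u][56u]\\ e(u)&=[31u][24u][56u]+[12u][53u][46u]+[25u][41u][36u]+[54u][32u][16u]+[43u][15u][26u]\\ f(u)&=[42u][35u][16u]+[23u][14u][56u]+[31u][52u][46u]+[15u][43u][26u]+[54u][21u][36u] \end{aligned}$$ The blow up of $\mathbb{P}^2$ at $p_1,\dots,p_6$ in Cremona hexahedral form is the cubic surface $S\subset\mathbb{P}^5$ that is the closure of $\{(a(u),b(u),c(u),d(u),e(u),f(u)) : u\in\mathbb{P}^2\}$. Equivalently it is the zero set in $\mathbb{P}^5$ of the Cremona hexahedral equations $\sum_{i=1}^6 z_i^3=0$, $\sum_{i=1}^6 z_i=0$, $\bar az_1+\bar bz_2+\bar cz_3+\bar dz_4+\bar ez_5+\bar fz_6=0$, where the scalars $\bar a,\dots,\bar f$ are obtained from the expressions for $a(u),\dots,f(u)$ by replacing each product $[iju][klu][rsu]$ with $[(ij)(kl)(rs)]:=[ijr][kls]-[ijs][klr]$, and $[ijl]$ is the determinant of the matrix with rows $p_i^\top,p_j^\top,p_l^\top$. $S_x=S_y$ means equality as subvarieties of $\mathbb{P}^5$. *)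

theory Defs
  imports "HOL-Analysis.Analysis"
begin

text \<open>
  A point of complex projective space is given by a nonzero vector of homogeneous coordinates,
  and a subset of projective space by the set of all nonzero coordinate vectors of its points.
  The six points are indexed by the numeral type \<^typ>\<open>6\<close>, whose elements are 1, ..., 5 and
  6 = 0.
\<close>

definition same_point :: "complex^'n \<Rightarrow> complex^'n \<Rightarrow> bool" where
  "same_point v w \<longleftrightarrow> (\<exists>c. c \<noteq> 0 \<and> v = c *s w)"

text \<open>
  Homogeneous polynomial functions of degree \<open>d\<close>; \<open>m\<close> ranges over the exponent vectors of
  total degree \<open>d\<close>, of which there are finitely many.
\<close>

definition forms :: "nat \<Rightarrow> (complex^'n::finite \<Rightarrow> complex) set" where
  "forms d = {F. \<exists>c. F = (\<lambda>z. \<Sum>m | (\<Sum>i\<in>UNIV. m i) = d. c m * (\<Prod>i\<in>UNIV. (z $ i) ^ m i))}"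

lemma finite_exponents: "finite {m :: 'n::finite \<Rightarrow> nat. (\<Sum>i\<in>UNIV. m i) = d}"
proof (rule finite_subset)
  show "{m :: 'n \<Rightarrow> nat. (\<Sum>i\<in>UNIV. m i) = d} \<subseteq> (\<Pi>\<^sub>E i\<in>UNIV. {..d})"
    by (auto simp: PiE_UNIV_domain intro: member_le_sum)
  show "finite (\<Pi>\<^sub>E i\<in>(UNIV :: 'n set). {..d})"
    by (intro finite_PiE) auto
qed

text \<open>Zariski closure in projective space.\<close>

definition proj_closure :: "(complex^'n::finite) set \<Rightarrow> (complex^'n) set" where
  "proj_closure X = {z. z \<noteq> 0 \<and> (\<forall>d. \<forall>F\<in>forms d. (\<forall>w\<in>X. F w = 0) \<longrightarrow> F z = 0)}"

text \<open>
  Incidences are counted by index, so points in general position are pairwise distinct.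
\<close>

definition general_position :: "(6 \<Rightarrow> complex^3) \<Rightarrow> bool" where
  "general_position p \<longleftrightarrow>
     (\<forall>L\<in>forms 1. L \<noteq> (\<lambda>_. 0) \<longrightarrow> card {i. L (p i) = 0} \<le> 2) \<and>
     (\<forall>Q\<in>forms 2. Q \<noteq> (\<lambda>_. 0) \<longrightarrow> card {i. Q (p i) = 0} \<le> 5)"

text \<open>The determinant \<open>[iju]\<close>, for the matrix with the given rows.\<close>

definition bracket :: "(6 \<Rightarrow> complex^3) \<Rightarrow> complex^3 \<Rightarrow> 6 \<Rightarrow> 6 \<Rightarrow> complex" where
  "bracket p u i j = det (vector [p i, p j, u] :: complex^3^3)"

text \<open>The vector of the six cubics \<open>a(u), ..., f(u)\<close>.\<close>

definition cremona_cubics :: "(6 \<Rightarrow> complex^3) \<Rightarrow> complex^3 \<Rightarrow> complex^6" where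
  "cremona_cubics p u =
     (let B = bracket p u in vector [
        B 2 5 * B 1 3 * B 4 6 + B 5 1 * B 4 2 * B 3 6
        + B 1 4 * B 3 5 * B 2 6 + B 4 3 * B 2 1 * B 5 6
        + B 3 2 * B 5 4 * B 1 6,
        B 5 3 * B 1 2 * B 4 6 + B 1 4 * B 2 3 * B 5 6
        + B 2 5 * B 3 4 * B 1 6 + B 3 1 * B 4 5 * B 2 6
        + B 4 2 * B 5 1 * B 3 6,
        B 5 3 * B 4 1 * B 2 6 + B 3 4 * B 2 5 * B 1 6
        + B 4 2 * B 1 3 * B 5 6 + B 2 1 * B 5 4 * B 3 6
        + B 1 5 * B 3 2 * B 4 6,
        B 4 5 * B 3 1 * B 2 6 + B 5 3 * B 2 4 * B 1 6
        + B 4 1 * B 2 5 * B 3 6 + B 3 2 * B 1 5 * B 4 6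
        + B 2 1 * B 4 3 * B 5 6,
        B 3 1 * B 2 4 * B 5 6 + B 1 2 * B 5 3 * B 4 6
        + B 2 5 * B 4 1 * B 3 6 + B 5 4 * B 3 2 * B 1 6
        + B 4 3 * B 1 5 * B 2 6,
        B 4 2 * B 3 5 * B 1 6 + B 2 3 * B 1 4 * B 5 6
        + B 3 1 * B 5 2 * B 4 6 + B 1 5 * B 4 3 * B 2 6
        + B 5 4 * B 2 1 * B 3 6])"

text \<open>
  The cubics vanish simultaneously at the six base points, where they define no point of
  projective 5-space.
\<close>

definition cremona_surface :: "(6 \<Rightarrow> complex^3) \<Rightarrow> (complex^6) set" where
  "cremona_surface p =
     proj_closure {z. z \<noteq> 0 \<and> (\<exists>u. u \<noteq> 0 \<and> same_point z (cremona_cubics p u))}"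

text \<open>The Kronecker product of two vectors, with its nine entries indexed by pairs.\<close>

definition kronecker :: "complex^3 \<Rightarrow> complex^3 \<Rightarrow> complex^(3 \<times> 3)" where
  "kronecker v w = (\<chi> k. v $ fst k * w $ snd k)"

definition Z_matrix :: "(6 \<Rightarrow> complex^3) \<Rightarrow> (6 \<Rightarrow> complex^3) \<Rightarrow> complex^(3 \<times> 3)^6" where
  "Z_matrix x y = (\<chi> i. kronecker (x i) (y i))"

end

theory Submission
  imports Defs "HOL-Computational_Algebra.Polynomial"
begin

text \<open>
  Three of the six points can be moved to the coordinate points by a homography. The other three
  are then the columns of a 3 by 3 matrix \<open>A\<close>, which is unique up to rescaling rows and columns
  (\<open>torus_equiv\<close>), and whose determinant, entries and cofactors are nonzero, because no three points
  are collinear. In this normal form \<open>(I | A)\<close>, the brackets \<open>[i (3+j) u]\<close> form a matrix \<open>joins A u\<close>,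
  and an invertible constant linear map sends the six products of its entries along permutations,
  the \<open>diag_products\<close>, to the six cubics. So everything can be read off from these products.

  Suppose that the surfaces of \<open>A\<close> and \<open>B\<close> agree. One linear relation between the products of
  \<open>joins A u\<close> has the products of \<open>A\<close> itself, with signs, as coefficients
  (\<open>signed_pairing_joins\<close>). It holds for \<open>B\<close> as well, and the relations for \<open>B\<close> are known
  (\<open>relation_coefficients\<close>), so the products of \<open>A\<close> have the form \<open>l b\<^sub>i + c\<close> where the \<open>b\<^sub>i\<close> are those
  of \<open>B\<close>. For every matrix, the three even products multiply to the same number as the three odd
  ones. This is a cubic equation that leaves two possibilities for the six numbers, up to a factor:
  they are the products of \<open>B\<close>, or those of the matrix of cofactors of \<open>B\<close>
  (\<open>torus_equiv_dichotomy\<close>). The first means that the point sets are related by a homography.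
  The second means that they are associated, that is, that the tensors \<open>x\<^sub>i \<otimes> y\<^sub>i\<close> are linearly
  dependent (\<open>associated_std_points\<close>).

  Conversely, homographies and rescaling of the points multiply all cubics by the same factor. For
  associated sets, which may be taken to be \<open>(I | A)\<close> and \<open>(I | C)\<close> with \<open>C\<close> the matrix of cofactors
  of \<open>A\<close>, there is a birational map of degree 5 between the planes such that \<open>joins C w\<close> and \<open>joins A u\<close> differ by rescaling rows
  and columns when \<open>u\<close> is the image of \<open>w\<close> (\<open>joins_partner\<close>). Such matrices have proportional
  diagonal products, so the two maps to projective 5-space agree generically, and their images have the
  same closure. Geometrically, the two planes arise by contracting the two halves of a double-six of
  lines on the surface when that surface is smooth.
\<close>

section \<open>Vectors with six entries\<close>

lemma exhaust_6:
  fixes x :: 6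
  shows "x = 1 \<or> x = 2 \<or> x = 3 \<or> x = 4 \<or> x = 5 \<or> x = 6"
proof (induct x)
  case (of_int z)
  then have "z = 0 \<or> z = 1 \<or> z = 2 \<or> z = 3 \<or> z = 4 \<or> z = 5" by fastforce
  then show ?case by auto
qed

lemma forall_6: "(\<forall>i::6. P i) \<longleftrightarrow> P 1 \<and> P 2 \<and> P 3 \<and> P 4 \<and> P 5 \<and> P 6"
  by (metis exhaust_6)

lemma UNIV_6: "UNIV = {1, 2, 3, 4, 5, 6::6}"
  using exhaust_6 by auto

lemma sum_6: "sum f (UNIV :: 6 set) = f 1 + f 2 + f 3 + f 4 + f 5 + f 6"
  unfolding UNIV_6 by (simp add: ac_simps)

lemma vector_6 [simp]:
  "(vector [a, b, c, d, e, f] :: 'a::zero^6) $ 1 = a"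
  "(vector [a, b, c, d, e, f] :: 'a::zero^6) $ 2 = b"
  "(vector [a, b, c, d, e, f] :: 'a::zero^6) $ 3 = c"
  "(vector [a, b, c, d, e, f] :: 'a::zero^6) $ 4 = d"
  "(vector [a, b, c, d, e, f] :: 'a::zero^6) $ 5 = e"
  "(vector [a, b, c, d, e, f] :: 'a::zero^6) $ 6 = f"
  unfolding vector_def by simp_all

lemma vec3_eq_iff: "(v :: 'a^3) = w \<longleftrightarrow> v $ 1 = w $ 1 \<and> v $ 2 = w $ 2 \<and> v $ 3 = w $ 3"
  by (simp add: vec_eq_iff forall_3)

lemma vec6_eq_iff: "(v :: 'a^6) = w \<longleftrightarrow> v $ 1 = w $ 1 \<and> v $ 2 = w $ 2 \<and> v $ 3 = w $ 3
    \<and> v $ 4 = w $ 4 \<and> v $ 5 = w $ 5 \<and> v $ 6 = w $ 6"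
  by (simp add: vec_eq_iff forall_6)

section \<open>The cubics of six points in normal form\<close>

text \<open>Matrix indices live in the type \<open>3\<close>, whose arithmetic is cyclic, so \<open>i + 1\<close> and \<open>i + 2\<close>
  are the two other indices in the order that makes cofactors and cross products free of signs.\<close>

lemma numeral_3_wrap [simp]: "(4 :: 3) = 1" "(5 :: 3) = 2" "(6 :: 3) = 3"
  by simp_all

definition cofactors :: "complex^3^3 \<Rightarrow> complex^3^3" where
  "cofactors A = (\<chi> i j. A $ (i+1) $ (j+1) * A $ (i+2) $ (j+2) - A $ (i+1) $ (j+2) * A $ (i+2) $ (j+1))"

text \<open>Column \<open>j\<close> is the cross product of column \<open>j\<close> of \<open>A\<close> with \<open>u\<close>: entry \<open>(i, j)\<close> is the bracket
  \<open>[i (3+j) u]\<close> for the six points formed by the unit vectors and the columns of \<open>A\<close>.\<close>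

definition joins :: "complex^3^3 \<Rightarrow> complex^3 \<Rightarrow> complex^3^3" where
  "joins A u = (\<chi> i j. A $ (i+1) $ j * u $ (i+2) - A $ (i+2) $ j * u $ (i+1))"

definition std_points :: "complex^3^3 \<Rightarrow> 6 \<Rightarrow> complex^3" where
  "std_points A i = (vector [axis 1 1, axis 2 1, axis 3 1,
     column 1 A, column 2 A, column 3 A] :: complex^3^6) $ i"

text \<open>The six terms of the Leibniz formula without their signs. The first three belong to the even
  permutations 123, 231, 312, the last three to the odd ones 132, 213, 321; both triples have
  the product of all nine entries as their product.\<close>

definition diag_products :: "complex^3^3 \<Rightarrow> complex^6" where
  "diag_products L = vector [
     L $ 1 $ 1 * L $ 2 $ 2 * L $ 3 $ 3,
     L $ 1 $ 2 * L $ 2 $ 3 * L $ 3 $ 1,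
     L $ 1 $ 3 * L $ 2 $ 1 * L $ 3 $ 2,
     L $ 1 $ 1 * L $ 2 $ 3 * L $ 3 $ 2,
     L $ 1 $ 2 * L $ 2 $ 1 * L $ 3 $ 3,
     L $ 1 $ 3 * L $ 2 $ 2 * L $ 3 $ 1]"

text \<open>The six ways to pair 1, 2, 3 with 4, 5, 6 correspond, under the outer automorphism of the
  symmetric group, to the pairs inside the two triples \<open>a, b, c\<close> and \<open>d, e, f\<close> of cubics: the sum of
  two cubics of the first triple is 4 times an odd product of brackets, and the sum of two of the
  second is -4 times an even one. Solving for the single cubics gives this linear map.\<close>

definition hexahedral :: "complex^6 \<Rightarrow> complex^6" where
  "hexahedral g = vector [
     2 * (g $ 5 + g $ 4 - g $ 6),
     2 * (g $ 5 + g $ 6 - g $ 4),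
     2 * (g $ 4 + g $ 6 - g $ 5),
     2 * (g $ 2 - g $ 1 - g $ 3),
     2 * (g $ 3 - g $ 1 - g $ 2),
     2 * (g $ 1 - g $ 2 - g $ 3)]"

lemma cremona_cubics_std_points:
  "cremona_cubics (std_points A) u = hexahedral (diag_products (joins A u))"
  unfolding cremona_cubics_def Let_def hexahedral_def diag_products_def vec6_eq_iff
  by (simp_all add: bracket_def det_3 std_points_def axis_def column_def joins_def)
    (simp_all add: algebra_simps)

section \<open>Linear relations between the cubics determine the points\<close>

text \<open>Rescaling rows and columns: the freedom that remains for the matrix \<open>A\<close> once three points are
  moved to the coordinate points.\<close>

definition torus_equiv :: "complex^3^3 \<Rightarrow> complex^3^3 \<Rightarrow> bool" where
  "torus_equiv A B \<longleftrightarrow> (\<exists>h k. (\<forall>i. h i \<noteq> 0 \<and> k i \<noteq> 0) \<and> (\<forall>i j. A $ i $ j = h i * k j * B $ i $ j))"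

definition nondegenerate :: "complex^3^3 \<Rightarrow> bool" where
  "nondegenerate A \<longleftrightarrow> det A \<noteq> 0 \<and> (\<forall>i j. A $ i $ j \<noteq> 0 \<and> cofactors A $ i $ j \<noteq> 0)"

lemma row_expansion:
  "det A = A $ i $ 1 * cofactors A $ i $ 1 + A $ i $ 2 * cofactors A $ i $ 2 + A $ i $ 3 * cofactors A $ i $ 3"
  using exhaust_3[of i] by (auto simp: det_3 cofactors_def algebra_simps)

text \<open>Two independent linear equations in three unknowns determine the solution up to a factor, which
  is the cross product of the coefficient rows.\<close>

lemma cross_kernel:
  fixes a b c p q r x y z :: complex
  assumes "a * x + b * y + c * z = 0" "p * x + q * y + r * z = 0"
    and "b * r - c * q \<noteq> 0"
  shows "\<exists>l. x = l * (b * r - c * q) \<and> y = l * (c * p - a * r) \<and> z = l * (a * q - b * p)"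
proof -
  have "y * (b * r - c * q) = x * (c * p - a * r)" "z * (b * r - c * q) = x * (a * q - b * p)"
    using assms(1,2) by algebra+
  then show ?thesis
    using assms(3) by (intro exI[of _ "x / (b * r - c * q)"]) (simp add: nonzero_eq_divide_eq)
qed

text \<open>Applied to the diagonal products of two matrices, this is the determinant of their entrywise
  product.\<close>

definition signed_pairing :: "complex^6 \<Rightarrow> complex^6 \<Rightarrow> complex" where
  "signed_pairing m g = m $ 1 * g $ 1 + m $ 2 * g $ 2 + m $ 3 * g $ 3
     - (m $ 4 * g $ 4 + m $ 5 * g $ 5 + m $ 6 * g $ 6)"

text \<open>The cubics satisfy no other linear relations than the two expected ones, whose coefficients are
  the diagonal products of \<open>B\<close> and a constant.

  On the line \<open>u\<^sub>i = 0\<close>, every diagonal product depends only on the column that its permutation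
  assigns to row \<open>i\<close>, so the coefficients enter only through the three differences for an even and
  an odd permutation that agree there. Two values of \<open>u\<close> give two equations, whose solution is the
  vector of products of an entry in row \<open>i\<close> with its cofactor, up to a factor \<open>l\<^sub>i\<close>. By row
  expansion, the sum of the three differences is \<open>l\<^sub>i\<close> times the determinant; but it is the sum of the even
  coefficients minus the sum of the odd ones, whatever \<open>i\<close> is. So the factors agree. Every even
  permutation agrees with every odd one of three letters in exactly one place, so all coefficients
  are then determined up to a common additive constant.\<close>

lemma relation_coefficients:
  assumes nd: "nondegenerate B"
    and rel: "\<And>u. signed_pairing m (diag_products (joins B u)) = 0"
  shows "\<exists>l c. \<forall>i. m $ i = l * diag_products B $ i + c"
proof -
  note rel = rel[unfolded signed_pairing_def diag_products_def joins_def, simplified]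
  have nz: "B $ i $ j \<noteq> 0" "cofactors B $ i $ j \<noteq> 0" for i j
    using nd by (auto simp: nondegenerate_def)
  have row1: "\<exists>l. m $ 1 - m $ 4 = l * B $ 1 $ 1 * cofactors B $ 1 $ 1 \<and>
      m $ 2 - m $ 5 = l * B $ 1 $ 2 * cofactors B $ 1 $ 2 \<and>
      m $ 3 - m $ 6 = l * B $ 1 $ 3 * cofactors B $ 1 $ 3"
  proof -
    let ?x = "(m $ 1 - m $ 4) * (B $ 1 $ 2 * B $ 1 $ 3)"
    let ?y = "(m $ 2 - m $ 5) * (B $ 1 $ 1 * B $ 1 $ 3)"
    let ?z = "(m $ 3 - m $ 6) * (B $ 1 $ 1 * B $ 1 $ 2)"
    \<comment> \<open>The sum and the difference of the two instances separate the coefficients of the two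
      monomials that occur for \<open>u 1 = 0\<close>.\<close>
    have "B $ 2 $ 1 * ?x + B $ 2 $ 2 * ?y + B $ 2 $ 3 * ?z = 0"
      "B $ 3 $ 1 * ?x + B $ 3 $ 2 * ?y + B $ 3 $ 3 * ?z = 0"
      using rel[of "vector [0, 1, 1]"] rel[of "vector [0, 1, -1]"]
      by (simp_all, algebra+)
    then obtain l where "?x = l * cofactors B $ 1 $ 1" "?y = l * cofactors B $ 1 $ 2" "?z = l * cofactors B $ 1 $ 3"
      using cross_kernel[of "B $ 2 $ 1" ?x "B $ 2 $ 2" ?y "B $ 2 $ 3" ?z "B $ 3 $ 1" "B $ 3 $ 2" "B $ 3 $ 3"] nz(2)[of 1 1]
      by (auto simp: cofactors_def)
    then show ?thesis
      using nz(1) by (intro exI[of _ "l / (B $ 1 $ 1 * B $ 1 $ 2 * B $ 1 $ 3)"]) (simp add: field_simps)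
  qed
  have row2: "\<exists>l. m $ 3 - m $ 5 = l * B $ 2 $ 1 * cofactors B $ 2 $ 1 \<and>
      m $ 1 - m $ 6 = l * B $ 2 $ 2 * cofactors B $ 2 $ 2 \<and>
      m $ 2 - m $ 4 = l * B $ 2 $ 3 * cofactors B $ 2 $ 3"
  proof -
    let ?x = "(m $ 3 - m $ 5) * (B $ 2 $ 2 * B $ 2 $ 3)"
    let ?y = "(m $ 1 - m $ 6) * (B $ 2 $ 1 * B $ 2 $ 3)"
    let ?z = "(m $ 2 - m $ 4) * (B $ 2 $ 1 * B $ 2 $ 2)"
    have "B $ 3 $ 1 * ?x + B $ 3 $ 2 * ?y + B $ 3 $ 3 * ?z = 0"
      "B $ 1 $ 1 * ?x + B $ 1 $ 2 * ?y + B $ 1 $ 3 * ?z = 0"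
      using rel[of "vector [1, 0, 1]"] rel[of "vector [1, 0, -1]"]
      by (simp_all, algebra+)
    then obtain l where "?x = l * cofactors B $ 2 $ 1" "?y = l * cofactors B $ 2 $ 2" "?z = l * cofactors B $ 2 $ 3"
      using cross_kernel[of "B $ 3 $ 1" ?x "B $ 3 $ 2" ?y "B $ 3 $ 3" ?z "B $ 1 $ 1" "B $ 1 $ 2" "B $ 1 $ 3"] nz(2)[of 2 1]
      by (auto simp: cofactors_def)
    then show ?thesis
      using nz(1) by (intro exI[of _ "l / (B $ 2 $ 1 * B $ 2 $ 2 * B $ 2 $ 3)"]) (simp add: field_simps)
  qed
  have row3: "\<exists>l. m $ 2 - m $ 6 = l * B $ 3 $ 1 * cofactors B $ 3 $ 1 \<and>
      m $ 3 - m $ 4 = l * B $ 3 $ 2 * cofactors B $ 3 $ 2 \<and>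
      m $ 1 - m $ 5 = l * B $ 3 $ 3 * cofactors B $ 3 $ 3"
  proof -
    let ?x = "(m $ 2 - m $ 6) * (B $ 3 $ 2 * B $ 3 $ 3)"
    let ?y = "(m $ 3 - m $ 4) * (B $ 3 $ 1 * B $ 3 $ 3)"
    let ?z = "(m $ 1 - m $ 5) * (B $ 3 $ 1 * B $ 3 $ 2)"
    have "B $ 1 $ 1 * ?x + B $ 1 $ 2 * ?y + B $ 1 $ 3 * ?z = 0"
      "B $ 2 $ 1 * ?x + B $ 2 $ 2 * ?y + B $ 2 $ 3 * ?z = 0"
      using rel[of "vector [1, 1, 0]"] rel[of "vector [1, -1, 0]"]
      by (simp_all, algebra+)
    then obtain l where "?x = l * cofactors B $ 3 $ 1" "?y = l * cofactors B $ 3 $ 2" "?z = l * cofactors B $ 3 $ 3"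
      using cross_kernel[of "B $ 1 $ 1" ?x "B $ 1 $ 2" ?y "B $ 1 $ 3" ?z "B $ 2 $ 1" "B $ 2 $ 2" "B $ 2 $ 3"] nz(2)[of 3 1]
      by (auto simp: cofactors_def)
    then show ?thesis
      using nz(1) by (intro exI[of _ "l / (B $ 3 $ 1 * B $ 3 $ 2 * B $ 3 $ 3)"]) (simp add: field_simps)
  qed
  obtain l1 where l1: "m $ 1 - m $ 4 = l1 * B $ 1 $ 1 * cofactors B $ 1 $ 1"
      "m $ 2 - m $ 5 = l1 * B $ 1 $ 2 * cofactors B $ 1 $ 2"
      "m $ 3 - m $ 6 = l1 * B $ 1 $ 3 * cofactors B $ 1 $ 3" using row1 by blast
  obtain l2 where l2: "m $ 3 - m $ 5 = l2 * B $ 2 $ 1 * cofactors B $ 2 $ 1"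
      "m $ 1 - m $ 6 = l2 * B $ 2 $ 2 * cofactors B $ 2 $ 2"
      "m $ 2 - m $ 4 = l2 * B $ 2 $ 3 * cofactors B $ 2 $ 3" using row2 by blast
  obtain l3 where l3: "m $ 2 - m $ 6 = l3 * B $ 3 $ 1 * cofactors B $ 3 $ 1"
      "m $ 3 - m $ 4 = l3 * B $ 3 $ 2 * cofactors B $ 3 $ 2"
      "m $ 1 - m $ 5 = l3 * B $ 3 $ 3 * cofactors B $ 3 $ 3" using row3 by blast
  let ?s = "m $ 1 + m $ 2 + m $ 3 - (m $ 4 + m $ 5 + m $ 6)"
  have "?s = l1 * det B" unfolding row_expansion[of B 1] using l1 by algebra
  moreover have "?s = l2 * det B" unfolding row_expansion[of B 2] using l2 by algebra
  moreover have "?s = l3 * det B" unfolding row_expansion[of B 3] using l3 by algebra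
  ultimately have eq: "l2 = l1" "l3 = l1"
    using nd by (auto simp: nondegenerate_def)
  define c where "c = m $ 1 - l1 * diag_products B $ 1"
  have "m $ 1 = l1 * diag_products B $ 1 + c" by (simp add: c_def)
  moreover have "m $ 4 = l1 * diag_products B $ 4 + c"
    using l1(1) by (simp add: c_def diag_products_def cofactors_def) algebra
  moreover have "m $ 5 = l1 * diag_products B $ 5 + c"
    using l3(3) by (simp add: eq c_def diag_products_def cofactors_def) algebra
  moreover have "m $ 6 = l1 * diag_products B $ 6 + c"
    using l2(2) by (simp add: eq c_def diag_products_def cofactors_def) algebra
  moreover have "m $ 2 = l1 * diag_products B $ 2 + c"
    using l1(1) l2(3) by (simp add: eq c_def diag_products_def cofactors_def) algebra
  moreover have "m $ 3 = l1 * diag_products B $ 3 + c"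
    using l1(1) l3(2) by (simp add: eq c_def diag_products_def cofactors_def) algebra
  ultimately show ?thesis unfolding forall_6 by blast
qed

text \<open>The entrywise product of \<open>A\<close> and \<open>joins A u\<close> has vanishing column sums, because a cross product
  with a column of \<open>A\<close> is orthogonal to that column; so its determinant vanishes.\<close>

lemma signed_pairing_joins: "signed_pairing (diag_products A) (diag_products (joins A u)) = 0"
  by (simp add: signed_pairing_def diag_products_def joins_def algebra_simps)

text \<open>Two permutations that differ by a transposition share one factor of their products. Cancelling
  it shows that the matrix of ratios of entries has vanishing 2 by 2 minors, so it has rank one.\<close>

lemma torus_equiv_if_proportional:
  assumes A: "\<And>i j. A $ i $ j \<noteq> 0" and B: "\<And>i j. B $ i $ j \<noteq> 0"
    and rel: "\<And>i. diag_products A $ i = c * diag_products B $ i"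
  shows "torus_equiv A B"
proof -
  have c: "c \<noteq> 0" using rel[of 1] A by (auto simp: diag_products_def)
  note p = rel[of 1] rel[of 2] rel[of 3] rel[of 4] rel[of 5] rel[of 6]
  note p = p[unfolded diag_products_def, simplified]
  have quad: "a * d * (b' * c') = b * cc * (a' * d')"
    if "a * d * e = c * (a' * d' * e')" "b * cc * e = c * (b' * c' * e')" "e \<noteq> 0" "e' \<noteq> 0"
    for a b cc d e a' b' c' d' e' :: complex
  proof -
    have "(a * d * (b' * c')) * (c * e * e') = (b * cc * (a' * d')) * (c * e * e')"
      using that by algebra
    then show ?thesis using that c by simp
  qed
  have 22: "A$1$1 * A$2$2 * (B$1$2 * B$2$1) = A$1$2 * A$2$1 * (B$1$1 * B$2$2)"
    by (rule quad[of _ _ "A$3$3" _ _ "B$3$3"]) (use p A B in \<open>simp_all add: ac_simps\<close>)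
  have 23: "A$1$1 * A$2$3 * (B$1$3 * B$2$1) = A$1$3 * A$2$1 * (B$1$1 * B$2$3)"
    by (rule quad[of _ _ "A$3$2" _ _ "B$3$2"]) (use p A B in \<open>simp_all add: ac_simps\<close>)
  have 32: "A$1$1 * A$3$2 * (B$1$2 * B$3$1) = A$1$2 * A$3$1 * (B$1$1 * B$3$2)"
    by (rule quad[of _ _ "A$2$3" _ _ "B$2$3"]) (use p A B in \<open>simp_all add: ac_simps\<close>)
  have 33: "A$1$1 * A$3$3 * (B$1$3 * B$3$1) = A$1$3 * A$3$1 * (B$1$1 * B$3$3)"
    by (rule quad[of _ _ "A$2$2" _ _ "B$2$2"]) (use p A B in \<open>simp_all add: ac_simps\<close>)
  show ?thesis
    unfolding torus_equiv_def using 22 23 32 33 A B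
    by (intro exI[of _ "\<lambda>i. A $ i $ 1 / B $ i $ 1"]
        exI[of _ "\<lambda>j. A $ 1 $ j * B $ 1 $ 1 / (B $ 1 $ j * A $ 1 $ 1)"]) (simp add: forall_3 field_simps)
qed

text \<open>The Leibniz terms of a matrix lie on the cubic hypersurface on which the product of the even
  coordinates equals the product of the odd ones. A line through the point of \<open>B\<close> in the direction
  of the constant vector meets it in that point, at infinity, and in a third point; the position of
  the third point is minus this number divided by the determinant of \<open>B\<close>.\<close>

definition third_root_shift :: "complex^3^3 \<Rightarrow> complex" where
  "third_root_shift B = (let p = diag_products B in
     p $ 1 * p $ 2 + p $ 1 * p $ 3 + p $ 2 * p $ 3 - (p $ 4 * p $ 5 + p $ 4 * p $ 6 + p $ 5 * p $ 6))"

text \<open>The third point on the line above is the one of the matrix of cofactors, up to a factor.\<close>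

lemma diag_products_cofactors:
  "diag_products (cofactors B) $ i = det B * diag_products B $ i - third_root_shift B"
proof -
  have "\<forall>i. diag_products (cofactors B) $ i = det B * diag_products B $ i - third_root_shift B"
    unfolding forall_6
    by (simp add: third_root_shift_def det_3 Let_def diag_products_def cofactors_def; algebra)
  then show ?thesis by blast
qed

text \<open>Inserting \<open>l b\<^sub>i + c\<close> into the cubic equation that the diagonal products of both matrices satisfy
  leaves \<open>c = 0\<close> or one further value of \<open>c\<close>, which belongs to the cofactors.\<close>

lemma torus_equiv_dichotomy:
  assumes A: "nondegenerate A" and B: "nondegenerate B"
    and rel: "\<And>i. diag_products A $ i = l * diag_products B $ i + c"
  shows "torus_equiv A B \<or> torus_equiv A (cofactors B)"
proof (cases "c = 0")
  case True
  then show ?thesis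
    using A B rel by (intro disjI1 torus_equiv_if_proportional) (auto simp: nondegenerate_def)
next
  case False
  let ?a = "\<lambda>i. diag_products A $ i" and ?b = "\<lambda>i. diag_products B $ i"
  have 1: "?a 1 * ?a 2 * ?a 3 = ?a 4 * ?a 5 * ?a 6" "?b 1 * ?b 2 * ?b 3 = ?b 4 * ?b 5 * ?b 6"
    by (simp_all add: diag_products_def)
  have 2: "?b 1 + ?b 2 + ?b 3 - (?b 4 + ?b 5 + ?b 6) = det B"
    by (simp add: diag_products_def det_3)
  have "?a 1 - ?a 4 \<noteq> 0"
  proof -
    have "?a 1 - ?a 4 = A $ 1 $ 1 * cofactors A $ 1 $ 1"
      by (simp add: diag_products_def cofactors_def algebra_simps)
    then show ?thesis using A by (simp add: nondegenerate_def)
  qed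
  then have l: "l \<noteq> 0" by (auto simp: rel)
  have "l * c * (l * third_root_shift B + c * det B) = 0"
    using 1 2 unfolding rel third_root_shift_def Let_def by algebra
  then have c: "c * det B = - l * third_root_shift B"
    using False l by (simp add: eq_neg_iff_add_eq_0 add.commute)
  have "diag_products A $ i = l / det B * diag_products (cofactors B) $ i" for i
    unfolding rel diag_products_cofactors using c B
    by (simp add: nondegenerate_def field_simps)
  then have "torus_equiv A (cofactors B)"
    by (rule torus_equiv_if_proportional[rotated 2]) (use A B in \<open>auto simp: nondegenerate_def\<close>)
  then show ?thesis ..
qed

section \<open>Functions that are polynomial on every line\<close>

text \<open>Polynomial dependence along every line is all that the density arguments need: it suffices to
  make the functions with this property behave like an integral domain.\<close>

definition line_poly :: "(complex^3 \<Rightarrow> complex) \<Rightarrow> bool" where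
  "line_poly f \<longleftrightarrow> (\<forall>a b. \<exists>p. \<forall>t. f (a + t *s b) = poly p t)"

lemma line_poly_const [intro, simp]: "line_poly (\<lambda>_. c)"
  unfolding line_poly_def by (intro allI exI[of _ "[:c:]"]) simp

lemma line_poly_nth [intro, simp]: "line_poly (\<lambda>w. w $ i)"
  unfolding line_poly_def
proof (intro allI)
  fix a b :: "complex^3"
  show "\<exists>p. \<forall>t. (a + t *s b) $ i = poly p t"
    by (intro exI[of _ "[:a $ i, b $ i:]"]) simp
qed

lemma line_poly_add [intro]: "line_poly f \<Longrightarrow> line_poly g \<Longrightarrow> line_poly (\<lambda>w. f w + g w)"
  unfolding line_poly_def by (metis poly_add)

lemma line_poly_diff [intro]: "line_poly f \<Longrightarrow> line_poly g \<Longrightarrow> line_poly (\<lambda>w. f w - g w)"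
  unfolding line_poly_def by (metis poly_diff)

lemma line_poly_mult [intro]: "line_poly f \<Longrightarrow> line_poly g \<Longrightarrow> line_poly (\<lambda>w. f w * g w)"
  unfolding line_poly_def by (metis poly_mult)

lemma line_poly_power [intro]: "line_poly f \<Longrightarrow> line_poly (\<lambda>w. f w ^ n)"
  by (induction n) auto

lemma line_poly_sum [intro]: "(\<And>i. i \<in> I \<Longrightarrow> line_poly (f i)) \<Longrightarrow> line_poly (\<lambda>w. \<Sum>i\<in>I. f i w)"
  by (induction I rule: infinite_finite_induct) auto

lemma line_poly_prod [intro]: "(\<And>i. i \<in> I \<Longrightarrow> line_poly (f i)) \<Longrightarrow> line_poly (\<lambda>w. \<Prod>i\<in>I. f i w)"
  by (induction I rule: infinite_finite_induct) auto

text \<open>On the line through a point where \<open>f\<close> does not vanish and one where \<open>g\<close> does not vanish, both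
  restrict to nonzero polynomials in one variable.\<close>

lemma line_poly_mult_nonzero:
  assumes f: "line_poly f" "f a \<noteq> 0" and g: "line_poly g" "g b \<noteq> 0"
  shows "\<exists>w. f w * g w \<noteq> 0"
proof (rule ccontr)
  assume "\<not> ?thesis"
  then have zero: "f w * g w = 0" for w by blast
  obtain p where p: "f (a + t *s (b - a)) = poly p t" for t
    using f(1) unfolding line_poly_def by blast
  obtain q where q: "g (a + t *s (b - a)) = poly q t" for t
    using g(1) unfolding line_poly_def by blast
  have "poly (p * q) t = 0" for t using zero by (simp flip: p q)
  then have "p * q = 0" using poly_all_0_iff_0 by blast
  moreover have "poly p 0 \<noteq> 0" using p[of 0] f(2) by simp
  moreover have "poly q 1 \<noteq> 0" using q[of 1] g(2) by simp
  ultimately show False by auto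
qed

lemma line_poly_common_nonzero:
  assumes "finite I" and "\<And>i. i \<in> I \<Longrightarrow> line_poly (f i) \<and> (\<exists>a. f i a \<noteq> 0)"
  shows "\<exists>w. \<forall>i\<in>I. f i w \<noteq> 0"
proof -
  have "\<exists>w. (\<Prod>i\<in>I. f i w) \<noteq> 0" using assms
  proof (induction I rule: finite_induct)
    case (insert x I)
    then obtain a b where "f x a \<noteq> 0" "(\<Prod>i\<in>I. f i b) \<noteq> 0" by blast
    moreover have "line_poly (f x)" "line_poly (\<lambda>w. \<Prod>i\<in>I. f i w)"
      using insert by (auto intro!: line_poly_prod)
    ultimately show ?case using line_poly_mult_nonzero[of "f x" a "\<lambda>w. \<Prod>i\<in>I. f i w" b] insert(1,2)
      by simp
  qed auto
  then show ?thesis using assms(1) by simp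
qed

lemma line_poly_form:
  assumes "F \<in> forms d" "\<And>i. line_poly (\<lambda>w. f w $ i)"
  shows "line_poly (\<lambda>w. F (f w))"
  using assms(1) unfolding forms_def 
  by (auto intro!: line_poly_sum line_poly_mult line_poly_prod line_poly_power assms(2))

text \<open>The exponent vectors of total degree 1 are the unit vectors.\<close>

lemma linear_form_in_forms: "(\<lambda>z :: complex^'n::finite. \<Sum>i\<in>UNIV. a i * z $ i) \<in> forms 1"
proof -
  let ?e = "\<lambda>i j :: 'n. if j = i then 1 else 0 :: nat"
  have inj: "inj ?e" by (rule injI) (metis zero_neq_one)
  have range: "{m :: 'n \<Rightarrow> nat. (\<Sum>i\<in>UNIV. m i) = 1} = range ?e"
  proof (intro equalityI subsetI)
    fix m :: "'n \<Rightarrow> nat" assume "m \<in> {m. (\<Sum>i\<in>UNIV. m i) = 1}"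
    then have "\<exists>i. m i = 1 \<and> (\<forall>j. j \<noteq> i \<longrightarrow> m j = 0)"
      by (simp add: sum_eq_Suc0_iff) metis
    then show "m \<in> range ?e" by (auto simp: image_iff fun_eq_iff)
  qed auto
  have "(\<Sum>m | (\<Sum>i\<in>UNIV. m i) = 1. (a (inv ?e m)) * (\<Prod>i\<in>UNIV. (z $ i) ^ m i)) = (\<Sum>i\<in>UNIV. a i * z $ i)"
    for z :: "complex^'n"
  proof -
    have "(\<Sum>m | (\<Sum>i\<in>UNIV. m i) = 1. (a (inv ?e m)) * (\<Prod>i\<in>UNIV. (z $ i) ^ m i))
      = (\<Sum>i\<in>UNIV. a (inv ?e (?e i)) * (\<Prod>j\<in>UNIV. (z $ j) ^ ?e i j))"
      unfolding range by (subst sum.reindex[OF inj]) simp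
    also have "\<dots> = (\<Sum>i\<in>UNIV. a i * z $ i)"
    proof (rule sum.cong[OF refl])
      fix i :: 'n
      have "(\<Prod>j\<in>UNIV. (z $ j) ^ ?e i j) = (\<Prod>j\<in>UNIV. if j = i then z $ j else 1)"
        by (intro prod.cong) auto
      then show "a (inv ?e (?e i)) * (\<Prod>j\<in>UNIV. (z $ j) ^ ?e i j) = a i * z $ i"
        using inv_f_f[OF inj, of i] by simp
    qed
    finally show ?thesis .
  qed
  then show ?thesis unfolding forms_def by (auto simp: fun_eq_iff intro!: exI[of _ "\<lambda>m. a (inv ?e m)"])
qed

section \<open>The surfaces of associated point sets\<close>

lemma line_poly_cremona_cubics: "line_poly (\<lambda>w. cremona_cubics p w $ i)"
proof -
  have b: "line_poly (\<lambda>w. bracket p w i j)" for i j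
    unfolding bracket_def det_3 vector_3
    by (intro line_poly_add line_poly_diff line_poly_mult line_poly_nth line_poly_const)
  have "\<forall>i. line_poly (\<lambda>w. cremona_cubics p w $ i)"
    unfolding forall_6 cremona_cubics_def Let_def vector_6
    by (intro conjI line_poly_add line_poly_mult b)
  then show ?thesis by blast
qed

text \<open>A form that vanishes on the image of the cubics of \<open>p\<close> pulls back along the cubics of \<open>q\<close> to a
  function that vanishes wherever none of the \<open>f i\<close> does. Such a function is identically zero, so the
  inclusion of the closures only has to be checked at generic points.\<close>

lemma cremona_surface_subset_generic:
  assumes I: "finite I" "\<And>i. i \<in> I \<Longrightarrow> line_poly (f i) \<and> (\<exists>a. f i a \<noteq> 0)"
    and step: "\<And>w. \<forall>i\<in>I. f i w \<noteq> 0 \<Longrightarrow>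
      cremona_cubics q w \<noteq> 0 \<and> (\<exists>u. u \<noteq> 0 \<and> same_point (cremona_cubics q w) (cremona_cubics p u))"
  shows "cremona_surface q \<subseteq> cremona_surface p"
proof
  let ?X = "\<lambda>p. {z. z \<noteq> 0 \<and> (\<exists>u. u \<noteq> 0 \<and> same_point z (cremona_cubics p u))}"
  fix z assume z: "z \<in> cremona_surface q"
  have "F z = 0" if F: "F \<in> forms d" "\<forall>w\<in>?X p. F w = 0" for d F
  proof -
    have "F v = 0" if v: "v \<in> ?X q" for v
    proof (rule ccontr)
      assume nz: "F v \<noteq> 0"
      obtain u c where c: "c \<noteq> 0" "v = c *s cremona_cubics q u"
        using v by (auto simp: same_point_def)
      let ?g = "\<lambda>w. F (c *s cremona_cubics q w)"
      have g: "line_poly ?g"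
        by (rule line_poly_form[OF F(1)]) (auto intro!: line_poly_mult line_poly_cremona_cubics)
      obtain a where "\<forall>i\<in>I. f i a \<noteq> 0" using line_poly_common_nonzero[of I f] I by blast
      then have a: "(\<Prod>i\<in>I. f i a) \<noteq> 0" using I(1) by simp
      have "\<exists>w. ?g w * (\<Prod>i\<in>I. f i w) \<noteq> 0"
        by (rule line_poly_mult_nonzero[of ?g u _ a]) (use g nz c a I in \<open>auto intro!: line_poly_prod\<close>)
      then obtain w where w: "?g w \<noteq> 0" "\<forall>i\<in>I. f i w \<noteq> 0"
        using I(1) by auto
      obtain u' e where u': "cremona_cubics q w \<noteq> 0" "u' \<noteq> 0" "e \<noteq> 0"
        "cremona_cubics q w = e *s cremona_cubics p u'"
        using step[OF w(2)] by (auto simp: same_point_def)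
      then have "c *s cremona_cubics q w \<in> ?X p"
        using c(1) by (auto simp: same_point_def vector_mul_eq_0 vector_smult_assoc
            intro!: exI[of _ u'] exI[of _ "c * e"])
      then show False using F(2) w(1) by blast
    qed
    then show ?thesis using z F(1) by (auto simp: cremona_surface_def proj_closure_def)
  qed
  then show "z \<in> cremona_surface p"
    using z by (auto simp: cremona_surface_def proj_closure_def)
qed

text \<open>The cross product of the first two columns of the entrywise product of \<open>A\<close> and
  \<open>joins (cofactors A) w\<close>. That product has vanishing row sums, so it is singular, and this vector
  annihilates its columns.\<close>

definition partner_scale :: "complex^3^3 \<Rightarrow> complex^3 \<Rightarrow> 3 \<Rightarrow> complex" where
  "partner_scale A w i = (let P = (\<lambda>i j. A $ i $ j * joins (cofactors A) w $ i $ j) in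
     P (i+1) 1 * P (i+2) 2 - P (i+2) 1 * P (i+1) 2)"

text \<open>The Cremona map of degree 5 between the planes of two associated point sets: both planes
  parametrize the same surface, and a generic \<open>w\<close> and its partner have the same image on it.\<close>

definition partner :: "complex^3^3 \<Rightarrow> complex^3 \<Rightarrow> complex^3" where
  "partner A w = (\<chi> i. w $ i * partner_scale A w (i+1) * partner_scale A w (i+2))"

text \<open>If the partner of \<open>w\<close> is column \<open>j\<close> of \<open>A\<close>, then \<open>w\<close> lies on this conic, which passes
  through the coordinate points and the two other columns of the matrix of cofactors.\<close>

definition exceptional_conic :: "complex^3^3 \<Rightarrow> 3 \<Rightarrow> complex^3 \<Rightarrow> complex" where
  "exceptional_conic A j w =
     (\<Sum>i\<in>UNIV. A $ i $ (j+1) / A $ i $ j * (w $ i * joins (cofactors A) w $ i $ (j+1)))"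

text \<open>A vector orthogonal to two vectors is parallel to their cross product.\<close>

lemma orthogonal_to_both:
  fixes a b c u v w p q r :: complex
  assumes "a * p + b * q + c * r = 0" "u * p + v * q + w * r = 0"
  shows "p * (c * u - a * w) = q * (b * w - c * v)"
    "p * (a * v - b * u) = r * (b * w - c * v)"
    "q * (a * v - b * u) = r * (c * u - a * w)"
  using assms by algebra+

text \<open>Multiply row \<open>i\<close> of \<open>joins (cofactors A) w\<close> by \<open>h i = partner_scale A w i\<close>. Column \<open>j\<close> of the result
  is orthogonal to column \<open>j\<close> of \<open>A\<close> by the choice of \<open>h\<close>, and to the partner \<open>u\<close> because
  \<open>u i * h i\<close> is proportional to \<open>w i\<close> and \<open>w\<close> is orthogonal to its own cross products. So it is
  parallel to their cross product, which is column \<open>j\<close> of \<open>joins A u\<close>. The conics guarantee that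
  the latter is not zero.\<close>

lemma joins_partner:
  assumes nd: "nondegenerate A"
    and w: "\<And>i j. joins (cofactors A) w $ i $ j \<noteq> 0" "\<And>i. partner_scale A w i \<noteq> 0"
      "\<And>j. exceptional_conic A j w \<noteq> 0"
  shows "partner A w \<noteq> 0 \<and> torus_equiv (joins (cofactors A) w) (joins A (partner A w))"
proof -
  let ?h = "partner_scale A w" and ?M = "joins (cofactors A) w" and ?u = "partner A w"
  let ?N = "joins A ?u"
  define H where "H = ?h 1 * ?h 2 * ?h 3"
  have H: "H \<noteq> 0" using w(2) by (simp add: H_def)
  have nzA: "A $ i $ j \<noteq> 0" for i j using nd by (simp add: nondegenerate_def)
  have uh: "?u $ i * ?h i = w $ i * H" for i
    using exhaust_3[of i] by (auto simp: partner_def H_def)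
  have rows: "A $ i $ 1 * ?M $ i $ 1 + A $ i $ 2 * ?M $ i $ 2 + A $ i $ 3 * ?M $ i $ 3 = 0" for i
    using exhaust_3[of i] by (auto simp: joins_def cofactors_def algebra_simps)
  have h: "?h 1 = A$2$1 * ?M$2$1 * (A$3$2 * ?M$3$2) - A$3$1 * ?M$3$1 * (A$2$2 * ?M$2$2)"
    "?h 2 = A$3$1 * ?M$3$1 * (A$1$2 * ?M$1$2) - A$1$1 * ?M$1$1 * (A$3$2 * ?M$3$2)"
    "?h 3 = A$1$1 * ?M$1$1 * (A$2$2 * ?M$2$2) - A$2$1 * ?M$2$1 * (A$1$2 * ?M$1$2)"
    by (simp_all add: partner_scale_def)
  have cols: "A $ 1 $ j * (?h 1 * ?M $ 1 $ j) + A $ 2 $ j * (?h 2 * ?M $ 2 $ j)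
      + A $ 3 $ j * (?h 3 * ?M $ 3 $ j) = 0" for j
  proof -
    consider "j = 1" | "j = 2" | "j = 3" using exhaust_3 by blast
    then show ?thesis
    proof cases
      case 1
      show ?thesis unfolding 1 h by algebra
    next
      case 2
      show ?thesis unfolding 2 h by algebra
    next
      case 3
      show ?thesis unfolding 3 h using rows[of 1] rows[of 2] rows[of 3] by algebra
    qed
  qed
  have orth: "?u $ 1 * (?h 1 * ?M $ 1 $ j) + ?u $ 2 * (?h 2 * ?M $ 2 $ j) + ?u $ 3 * (?h 3 * ?M $ 3 $ j) = 0" for j
  proof -
    have "w $ 1 * ?M $ 1 $ j + w $ 2 * ?M $ 2 $ j + w $ 3 * ?M $ 3 $ j = 0"
      by (simp add: joins_def algebra_simps)
    then show ?thesis using uh[of 1] uh[of 2] uh[of 3] by algebra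
  qed
  have N: "?N $ 1 $ j = A $ 2 $ j * ?u $ 3 - A $ 3 $ j * ?u $ 2"
    "?N $ 2 $ j = A $ 3 $ j * ?u $ 1 - A $ 1 $ j * ?u $ 3"
    "?N $ 3 $ j = A $ 1 $ j * ?u $ 2 - A $ 2 $ j * ?u $ 1" for j
    by (simp_all add: joins_def)
  have par: "\<forall>i k. ?h i * ?M $ i $ j * ?N $ k $ j = ?h k * ?M $ k $ j * ?N $ i $ j" for j
    unfolding forall_3 N using orthogonal_to_both[OF cols[of j] orth[of j]] by simp
  have nz: "?N $ i $ j \<noteq> 0" for i j
  proof
    assume "?N $ i $ j = 0"
    then have "?N $ k $ j = 0" for k
      using par[of j] w(1,2) by (metis mult_eq_0_iff)
    then have z: "A $ 3 $ j * ?u $ 1 = A $ 1 $ j * ?u $ 3" "A $ 1 $ j * ?u $ 2 = A $ 2 $ j * ?u $ 1"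
      using N[of j] by simp_all
    \<comment> \<open>The partner would be column \<open>j\<close> of \<open>A\<close>; then \<open>w\<close> is on the exceptional conic of \<open>j\<close>.\<close>
    define t where "t = ?u $ 1 / A $ 1 $ j"
    have "?u $ 1 = t * A $ 1 $ j" "?u $ 2 = t * A $ 2 $ j" "?u $ 3 = t * A $ 3 $ j"
      using z nzA[of 1 j] by (simp_all add: t_def field_simps)
    then have "\<forall>i. ?u $ i = t * A $ i $ j" by (simp add: forall_3)
    then have wH: "w $ i * H = t * A $ i $ j * ?h i" for i using uh[of i] by simp
    have "exceptional_conic A j w * H = (\<Sum>i\<in>UNIV. A $ i $ (j+1) / A $ i $ j * (w $ i * H) * ?M $ i $ (j+1))"
      unfolding exceptional_conic_def sum_distrib_right by (intro sum.cong refl) (simp only: mult_ac)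
    also have "\<dots> = t * (\<Sum>i\<in>UNIV. A $ i $ (j+1) * (?h i * ?M $ i $ (j+1)))"
      unfolding wH sum_distrib_left by (intro sum.cong refl) (simp add: nzA)
    also have "\<dots> = 0" using cols[of "j+1"] by (simp add: sum_3)
    finally show False using H w(3) by simp
  qed
  have eq: "?M $ i $ j = (1 / ?h i) * (?h 1 * ?M $ 1 $ j / ?N $ 1 $ j) * ?N $ i $ j" for i j
    using par[of j] w(2)[of i] nz[of 1 j] by (simp add: field_simps)
  have "torus_equiv ?M ?N"
    unfolding torus_equiv_def
  proof (intro exI conjI allI)
    show "?M $ i $ j = (1 / ?h i) * (?h 1 * ?M $ 1 $ j / ?N $ 1 $ j) * ?N $ i $ j" for i j
      by (rule eq)
  qed (use w(1,2) nz in simp_all)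
  moreover have "?u \<noteq> 0" using nz[of 1 1] by (auto simp: joins_def)
  ultimately show ?thesis by blast
qed

lemma diag_products_torus:
  assumes "torus_equiv A B"
  shows "\<exists>c. c \<noteq> 0 \<and> diag_products A = c *s diag_products B"
proof -
  obtain h k where hk: "\<forall>i. h i \<noteq> 0 \<and> k i \<noteq> 0" "\<forall>i j. A $ i $ j = h i * k j * B $ i $ j"
    using assms unfolding torus_equiv_def by blast
  then show ?thesis
    by (intro exI[of _ "h 1 * h 2 * h 3 * k 1 * k 2 * k 3"])
      (simp add: vec6_eq_iff diag_products_def)
qed

lemma hexahedral_smult: "hexahedral (c *s g) = c *s hexahedral g"
  by (simp add: vec6_eq_iff hexahedral_def algebra_simps)

lemma hexahedral_nonzero: "hexahedral g = 0 \<Longrightarrow> g = 0"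
  by (simp add: vec6_eq_iff hexahedral_def) algebra

text \<open>By the previous lemmas the cubics of both point sets agree, up to a factor, at \<open>w\<close> and its partner
  for generic \<open>w\<close>. What has to be verified is that none of the genericity conditions excludes all
  \<open>w\<close>; each is a form of degree at most two that is evaluated at a suitable point.\<close>

lemma cremona_surface_cofactors_subset:
  assumes nd: "nondegenerate A"
  shows "cremona_surface (std_points (cofactors A)) \<subseteq> cremona_surface (std_points A)"
proof -
  let ?C = "cofactors A"
  have nz: "A $ i $ j \<noteq> 0" "cofactors A $ i $ j \<noteq> 0" for i j
    using nd by (auto simp: nondegenerate_def)
  define f where "f = (\<lambda>(n::nat, i, j). if n = 0 then (\<lambda>w. joins ?C w $ i $ j)
    else if n = 1 then (\<lambda>w. partner_scale A w i) else exceptional_conic A j)"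
  show ?thesis
  proof (rule cremona_surface_subset_generic[of "{0, 1, 2} \<times> UNIV" f])
    have j: "line_poly (\<lambda>w. joins ?C w $ i $ j)" for i j
      unfolding joins_def by (auto intro!: line_poly_diff line_poly_mult)
    have j0: "\<exists>w. joins ?C w $ i $ j \<noteq> 0" for i j
      using nz(2)[of "i+1" j] exhaust_3[of i] by (intro exI[of _ "axis (i+2) 1"]) (auto simp: joins_def axis_def)
    have s: "line_poly (\<lambda>w. partner_scale A w i)" for i
      unfolding partner_scale_def Let_def by (intro line_poly_diff line_poly_mult line_poly_const j)
    have s0: "\<exists>w. partner_scale A w i \<noteq> 0" for i
    proof -
      \<comment> \<open>For \<open>w i = 0\<close>, only the mixed monomial in the other two coordinates remains.\<close>
      let ?w = "(\<chi> k. if k = i then 0 else 1) :: complex^3"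
      have "partner_scale A ?w i = - (?C $ i $ 1 * ?C $ i $ 2 * ?C $ i $ 3)"
        using exhaust_3[of i] by (auto simp: partner_scale_def joins_def) (simp_all add: cofactors_def algebra_simps)
      then show ?thesis using nz by (intro exI[of _ ?w]) simp
    qed
    have e: "line_poly (exceptional_conic A j)" for j
      unfolding exceptional_conic_def by (intro line_poly_sum line_poly_mult line_poly_const line_poly_nth j)
    have e0: "\<exists>w. exceptional_conic A j w \<noteq> 0" for j
    proof -
      \<comment> \<open>The quadratic form has no squares, so this reads off a single coefficient.\<close>
      let ?w = "vector [1, 1, 0] :: complex^3"
      have "exceptional_conic A j ?w = ?C $ 3 $ (j+1) * ?C $ 3 $ (j+2) / (A $ 1 $ j * A $ 2 $ j)"
        using exhaust_3[of j] nz by (auto simp: exceptional_conic_def joins_def sum_3)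
          (simp_all add: cofactors_def field_simps)
      then show ?thesis using nz by (intro exI[of _ ?w]) simp
    qed
    show "line_poly (f i) \<and> (\<exists>a. f i a \<noteq> 0)" for i
      using j j0 s s0 e e0 by (cases i) (auto simp: f_def)
  next
    fix w assume "\<forall>i\<in>{0, 1, 2} \<times> UNIV. f i w \<noteq> 0"
    then have w: "f (0, i, j) w \<noteq> 0" "f (1, i, j) w \<noteq> 0" "f (2, i, j) w \<noteq> 0" for i j
      by blast+
    have M: "joins ?C w $ i $ j \<noteq> 0" for i j using w(1)[of i j] by (simp add: f_def)
    have *: "partner A w \<noteq> 0" "torus_equiv (joins ?C w) (joins A (partner A w))"
      using joins_partner[OF nd M] w(2,3) by (auto simp: f_def)
    obtain c where c: "c \<noteq> 0" "diag_products (joins ?C w) = c *s diag_products (joins A (partner A w))"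
      using diag_products_torus[OF *(2)] by blast
    have "diag_products (joins ?C w) $ 1 \<noteq> 0" using M by (simp add: diag_products_def)
    then have "diag_products (joins ?C w) \<noteq> 0" by auto
    then have "cremona_cubics (std_points ?C) w \<noteq> 0"
      unfolding cremona_cubics_std_points using hexahedral_nonzero by blast
    moreover have "same_point (cremona_cubics (std_points ?C) w) (cremona_cubics (std_points A) (partner A w))"
      unfolding same_point_def cremona_cubics_std_points c(2) hexahedral_smult using c(1) by blast
    ultimately show "cremona_cubics (std_points ?C) w \<noteq> 0 \<and>
      (\<exists>u. u \<noteq> 0 \<and> same_point (cremona_cubics (std_points ?C) w) (cremona_cubics (std_points A) u))"
      using *(1) by blast
  qed simp
qed

section \<open>Homographies and the normal form\<close>

definition proj_equiv :: "(6 \<Rightarrow> complex^3) \<Rightarrow> (6 \<Rightarrow> complex^3) \<Rightarrow> bool" where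
  "proj_equiv x y \<longleftrightarrow> (\<exists>H :: complex^3^3. invertible H \<and> (\<forall>i. same_point (H *v x i) (y i)))"

lemma proj_equiv_sym:
  assumes "proj_equiv x y"
  shows "proj_equiv y x"
proof -
  obtain H :: "complex^3^3" where H: "invertible H" "\<And>i. \<exists>c. c \<noteq> 0 \<and> H *v x i = c *s y i"
    using assms unfolding proj_equiv_def same_point_def by blast
  obtain K where K: "K ** H = mat 1" "H ** K = mat 1" using H(1) unfolding invertible_def by blast
  have "\<exists>c. c \<noteq> 0 \<and> K *v y i = c *s x i" for i
  proof -
    obtain c where c: "c \<noteq> 0" "H *v x i = c *s y i" using H(2) by blast
    have "c *s (K *v y i) = x i"
      using arg_cong[OF c(2), of "(*v) K"] by (simp add: matrix_vector_mul_assoc K vec.scale)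
    from arg_cong[OF this, of "(*s) (1 / c)"] have "K *v y i = (1 / c) *s x i"
      using c(1) by (simp add: vector_smult_assoc)
    then show ?thesis using c(1) by (intro exI[of _ "1 / c"]) simp
  qed
  moreover have "invertible K" using K unfolding invertible_def by blast
  ultimately show ?thesis unfolding proj_equiv_def same_point_def by blast
qed

lemma proj_equiv_trans:
  assumes "proj_equiv x y" "proj_equiv y z"
  shows "proj_equiv x z"
proof -
  obtain H K :: "complex^3^3" where HK: "invertible H" "\<forall>i. \<exists>c. c \<noteq> 0 \<and> H *v x i = c *s y i"
    "invertible K" "\<forall>i. \<exists>c. c \<noteq> 0 \<and> K *v y i = c *s z i"
    using assms unfolding proj_equiv_def same_point_def by blast
  have "\<exists>c. c \<noteq> 0 \<and> (K ** H) *v x i = c *s z i" for i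
  proof -
    obtain c d where "c \<noteq> 0" "H *v x i = c *s y i" "d \<noteq> 0" "K *v y i = d *s z i" using HK by metis
    then show ?thesis
      by (intro exI[of _ "c * d"]) (simp flip: matrix_vector_mul_assoc add: vec.scale vector_smult_assoc)
  qed
  moreover have "invertible (K ** H)" using HK by (simp add: invertible_mult)
  ultimately show ?thesis unfolding proj_equiv_def same_point_def by blast
qed

lemma det_rows_image:
  fixes H :: "complex^3^3"
  shows "det (vector [H *v a, H *v b, H *v c] :: complex^3^3) = det H * det (vector [a, b, c] :: complex^3^3)"
  by (simp add: det_3 matrix_vector_mult_def sum_3 algebra_simps)

text \<open>Each term is a product of three brackets, and every bracket contributes one determinant of \<open>H\<close>.\<close>

lemma cremona_cubics_homography:
  "cremona_cubics (\<lambda>i. H *v p i) (H *v u) = (det H ^ 3) *s cremona_cubics p u"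
  by (simp add: vec6_eq_iff cremona_cubics_def Let_def bracket_def det_rows_image power3_eq_cube algebra_simps)

text \<open>Each term contains every one of the six points exactly once.\<close>

lemma cremona_cubics_scale:
  "cremona_cubics (\<lambda>i. s i *s p i) u = (s 1 * s 2 * s 3 * s 4 * s 5 * s 6) *s cremona_cubics p u"
proof -
  have "bracket (\<lambda>i. s i *s p i) u i j = s i * s j * bracket p u i j" for i j
    by (simp add: bracket_def det_3 algebra_simps)
  then show ?thesis by (simp add: vec6_eq_iff cremona_cubics_def Let_def algebra_simps)
qed

lemma proj_closure_mono: "X \<subseteq> Y \<Longrightarrow> proj_closure X \<subseteq> proj_closure Y"
  unfolding proj_closure_def by (rule Collect_mono) blast

lemma cremona_surface_proj_equiv_subset:
  assumes "proj_equiv x y"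
  shows "cremona_surface x \<subseteq> cremona_surface y"
  unfolding cremona_surface_def
proof (intro proj_closure_mono subsetI)
  obtain H :: "complex^3^3" and s where H: "invertible H" "\<And>i. s i \<noteq> 0" "\<And>i. H *v x i = s i *s y i"
    using assms unfolding proj_equiv_def same_point_def by metis
  have d: "det H \<noteq> 0" using H(1) by (simp add: invertible_det_nz)
  fix z assume "z \<in> {z. z \<noteq> 0 \<and> (\<exists>u. u \<noteq> 0 \<and> same_point z (cremona_cubics x u))}"
  then obtain u c where z: "z \<noteq> 0" "u \<noteq> 0" "c \<noteq> 0" "z = c *s cremona_cubics x u"
    by (auto simp: same_point_def)
  let ?S = "s 1 * s 2 * s 3 * s 4 * s 5 * s 6"
  have "(det H ^ 3) *s cremona_cubics x u = ?S *s cremona_cubics y (H *v u)"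
    unfolding cremona_cubics_homography[symmetric] H(3) cremona_cubics_scale ..
  from arg_cong[OF this, of "(*s) (c / det H ^ 3)"]
  have "z = (c * ?S / det H ^ 3) *s cremona_cubics y (H *v u)"
    using d by (simp add: vector_smult_assoc z(4))
  moreover have "H *v u \<noteq> 0"
    using H(1) z(2) by (metis invertible_left_inverse matrix_left_invertible_ker invertible_def)
  ultimately show "z \<in> {z. z \<noteq> 0 \<and> (\<exists>u. u \<noteq> 0 \<and> same_point z (cremona_cubics y u))}"
    using z d H(2) by (auto simp: same_point_def intro!: exI[of _ "H *v u"] exI[of _ "c * ?S / det H ^ 3"])
qed

lemma cremona_surface_proj_equiv: "proj_equiv x y \<Longrightarrow> cremona_surface x = cremona_surface y"
  using cremona_surface_proj_equiv_subset proj_equiv_sym by blast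

lemma std_points_nth [simp]:
  "std_points A 1 = axis 1 1" "std_points A 2 = axis 2 1" "std_points A 3 = axis 3 1"
  "std_points A 4 = column 1 A" "std_points A 5 = column 2 A" "std_points A 6 = column 3 A"
  by (simp_all add: std_points_def)

lemma torus_equiv_imp_proj_equiv:
  assumes "torus_equiv A B"
  shows "proj_equiv (std_points A) (std_points B)"
proof -
  obtain h k where hk: "\<And>i. h i \<noteq> 0" "\<And>i. k i \<noteq> 0" "\<And>i j. A $ i $ j = h i * k j * B $ i $ j"
    using assms unfolding torus_equiv_def by blast
  define H :: "complex^3^3" where "H = (\<chi> i j. if i = j then 1 / h i else 0)"
  define s where "s = (\<lambda>i :: 6. (vector [1 / h 1, 1 / h 2, 1 / h 3, k 1, k 2, k 3] :: complex^6) $ i)"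
  have "invertible H"
    using hk(1) by (simp add: invertible_det_nz det_3 H_def)
  moreover have "\<forall>i. s i \<noteq> 0" using hk(1,2) by (simp add: forall_6 s_def)
  moreover have "\<forall>i. H *v std_points A i = s i *s std_points B i"
    unfolding forall_6 using hk
    by (simp add: vec3_eq_iff s_def H_def matrix_vector_mult_def sum_3 axis_def column_def)
  ultimately show ?thesis unfolding proj_equiv_def same_point_def by blast
qed

definition no_three_collinear :: "(6 \<Rightarrow> complex^3) \<Rightarrow> bool" where
  "no_three_collinear x \<longleftrightarrow>
     (\<forall>i j k. i \<noteq> j \<and> i \<noteq> k \<and> j \<noteq> k \<longrightarrow> det (vector [x i, x j, x k] :: complex^3^3) \<noteq> 0)"

text \<open>A vanishing determinant of three points yields a nonzero linear form that vanishes at all three.\<close>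

lemma general_position_no_three_collinear:
  assumes "general_position x"
  shows "no_three_collinear x"
  unfolding no_three_collinear_def
proof (intro allI impI notI)
  fix i j k assume ijk: "i \<noteq> j \<and> i \<noteq> k \<and> j \<noteq> k"
    and "det (vector [x i, x j, x k] :: complex^3^3) = 0"
  then obtain l where l: "l \<noteq> 0" "(vector [x i, x j, x k] :: complex^3^3) *v l = 0"
    by (metis invertible_det_nz invertible_left_inverse matrix_left_invertible_ker)
  define L where "L = (\<lambda>z :: complex^3. \<Sum>a\<in>UNIV. l $ a * z $ a)"
  have "L \<in> forms 1" unfolding L_def by (rule linear_form_in_forms)
  moreover have "L \<noteq> (\<lambda>_. 0)"
  proof
    assume L0: "L = (\<lambda>_. 0)"
    have "l $ a = 0" for a
    proof -
      have "L (axis a 1) = l $ a" by (simp add: L_def axis_def if_distrib cong: if_cong)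
      then show ?thesis using L0 by simp
    qed
    then show False using l(1) by (simp add: vec_eq_iff)
  qed
  moreover have "card {i. L (x i) = 0} \<ge> 3"
  proof -
    have "{i, j, k} \<subseteq> {i. L (x i) = 0}"
      using l(2) by (simp add: L_def vec3_eq_iff matrix_vector_mult_def sum_3 mult.commute)
    then have "card {i, j, k} \<le> card {i. L (x i) = 0}" by (intro card_mono) auto
    then show ?thesis using ijk by simp
  qed
  ultimately show False using assms unfolding general_position_def by fastforce
qed

text \<open>Determinant, entries and cofactors of \<open>A\<close> are, up to sign, the brackets of the triples of points
  that contain none, two and one of the coordinate points.\<close>

lemma nondegenerate_if_no_three_collinear:
  assumes "no_three_collinear (std_points A)"
  shows "nondegenerate A"
proof -
  note d = assms[unfolded no_three_collinear_def, rule_format]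
  have "det A \<noteq> 0" using d[of 4 5 6] by (simp add: det_3 column_def algebra_simps)
  moreover have "\<forall>i j. A $ i $ j \<noteq> 0"
    unfolding forall_3 using d[of 2 3 4] d[of 1 3 4] d[of 1 2 4] d[of 2 3 5] d[of 1 3 5] d[of 1 2 5]
      d[of 2 3 6] d[of 1 3 6] d[of 1 2 6]
    by (simp add: det_3 column_def axis_def)
  moreover have "\<forall>i j. cofactors A $ i $ j \<noteq> 0"
    unfolding forall_3 using d[of 1 4 5] d[of 1 4 6] d[of 1 5 6] d[of 2 4 5] d[of 2 4 6] d[of 2 5 6]
      d[of 3 4 5] d[of 3 4 6] d[of 3 5 6]
    by (simp add: det_3 column_def axis_def cofactors_def algebra_simps)
  ultimately show ?thesis by (simp add: nondegenerate_def)
qed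

lemma normal_form:
  assumes "no_three_collinear x"
  shows "\<exists>A. nondegenerate A \<and> proj_equiv x (std_points A)"
proof -
  define M :: "complex^3^3" where "M = vector [x 1, x 2, x 3]"
  have "det M \<noteq> 0" using assms by (auto simp: M_def no_three_collinear_def)
  then have inv: "invertible (transpose M)" by (simp add: invertible_det_nz det_transpose)
  obtain H where H: "H ** transpose M = mat 1" "transpose M ** H = mat 1"
    using inv unfolding invertible_def by blast
  then have iH: "invertible H" unfolding invertible_def by blast
  have "transpose M *v axis 1 1 = x 1" "transpose M *v axis 2 1 = x 2" "transpose M *v axis 3 1 = x 3"
    by (simp_all add: M_def vec3_eq_iff transpose_def matrix_vector_mult_def sum_3 axis_def)
  then have e: "H *v x 1 = axis 1 1" "H *v x 2 = axis 2 1" "H *v x 3 = axis 3 1"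
    using H(1) by (metis matrix_vector_mul_assoc matrix_vector_mul_lid)+
  define A :: "complex^3^3" where "A = transpose (vector [H *v x 4, H *v x 5, H *v x 6])"
  have c: "column 1 A = H *v x 4" "column 2 A = H *v x 5" "column 3 A = H *v x 6"
    by (simp_all add: A_def column_def transpose_def vec3_eq_iff)
  have "\<forall>i. H *v x i = std_points A i"
    unfolding forall_6 by (simp add: e c)
  then have std: "std_points A i = H *v x i" for i by simp
  have "same_point (H *v x i) (std_points A i)" for i
    unfolding same_point_def std by (intro exI[of _ 1]) simp
  then have "proj_equiv x (std_points A)"
    unfolding proj_equiv_def using iH by blast
  moreover have "no_three_collinear (std_points A)"
    using assms iH unfolding no_three_collinear_def std det_rows_image invertible_det_nz by simp
  ultimately show ?thesis using nondegenerate_if_no_three_collinear by blast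
qed

section \<open>Equality of surfaces in normal form\<close>

text \<open>A linear relation between the cubics of \<open>A\<close> is a form of degree 1 that vanishes on the first
  surface; so it vanishes on the image of the cubics of \<open>B\<close>.\<close>

lemma cremona_surface_eq_imp_relation:
  assumes "cremona_surface (std_points A) = cremona_surface (std_points B)"
  shows "signed_pairing (diag_products A) (diag_products (joins B u)) = 0"
proof -
  define m where "m = diag_products A"
  \<comment> \<open>The linear form is the sum of \<open>m k\<close> times the sum of two coordinates that belongs to product \<open>k\<close>.\<close>
  define a :: "complex^6" where "a = vector [m $ 4 + m $ 5, m $ 5 + m $ 6, m $ 4 + m $ 6,
      m $ 1 + m $ 3, m $ 1 + m $ 2, m $ 2 + m $ 3]"
  define F where "F = (\<lambda>z :: complex^6. \<Sum>i\<in>UNIV. a $ i * z $ i)"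
  have F: "F \<in> forms 1" unfolding F_def by (rule linear_form_in_forms)
  have hex: "F (hexahedral g) = - 4 * signed_pairing m g" for g
    by (simp add: signed_pairing_def F_def sum_6 a_def hexahedral_def algebra_simps)
  have scale: "F (c *s z) = c * F z" for c z
    by (simp add: F_def sum_distrib_left mult_ac)
  have "F z = 0" if "z \<in> cremona_surface (std_points A)" for z
  proof -
    have "F w = 0" if "same_point w (cremona_cubics (std_points A) u)" for w u
      using that by (auto simp: same_point_def scale cremona_cubics_std_points hex m_def signed_pairing_joins)
    then show ?thesis using that F unfolding cremona_surface_def proj_closure_def by blast
  qed
  moreover have "cremona_cubics (std_points B) u \<in> cremona_surface (std_points B)"
    if nz: "cremona_cubics (std_points B) u \<noteq> 0"
  proof -
    have "u \<noteq> 0"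
      using nz by (auto simp: cremona_cubics_std_points joins_def diag_products_def hexahedral_def vec6_eq_iff)
    moreover have "same_point (cremona_cubics (std_points B) u) (cremona_cubics (std_points B) u)"
      unfolding same_point_def by (intro exI[of _ 1]) simp
    ultimately show ?thesis using nz unfolding cremona_surface_def proj_closure_def by blast
  qed
  moreover have "F 0 = 0" by (simp add: F_def)
  ultimately have "F (cremona_cubics (std_points B) u) = 0" using assms by metis
  then show ?thesis by (simp add: cremona_cubics_std_points hex m_def)
qed

lemma cofactors_orthogonal:
  "(\<Sum>j\<in>UNIV. cofactors B $ a $ j * B $ b $ j) = (if a = b then det B else 0)"
  using exhaust_3[of a] exhaust_3[of b]
  by (auto simp: sum_3 det_3 cofactors_def algebra_simps)

lemma cofactors_orthogonal':
  "(\<Sum>b\<in>UNIV. cofactors B $ b $ j * B $ b $ k) = (if j = k then det B else 0)"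
  using exhaust_3[of j] exhaust_3[of k]
  by (auto simp: sum_3 det_3 cofactors_def algebra_simps)

lemma cofactors_cofactors: "cofactors (cofactors B) $ i $ j = det B * B $ i $ j"
  using exhaust_3[of i] exhaust_3[of j]
  by (auto simp: det_3 cofactors_def algebra_simps)

lemma nondegenerate_cofactors:
  assumes "nondegenerate B"
  shows "nondegenerate (cofactors B)"
proof -
  have "det (cofactors B) = det B * det B"
    by (simp add: det_3 cofactors_def algebra_simps)
  then show ?thesis using assms by (simp add: nondegenerate_def cofactors_cofactors)
qed

text \<open>One inclusion implies the other because taking cofactors twice returns the matrix up to a factor.\<close>

lemma cremona_surface_cofactors:
  assumes "nondegenerate A"
  shows "cremona_surface (std_points (cofactors A)) = cremona_surface (std_points A)"
proof
  have "torus_equiv A (cofactors (cofactors A))"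
    unfolding torus_equiv_def using assms
    by (intro exI[of _ "\<lambda>_. 1"] exI[of _ "\<lambda>_. 1 / det A"]) (simp add: cofactors_cofactors nondegenerate_def)
  then have "cremona_surface (std_points A) = cremona_surface (std_points (cofactors (cofactors A)))"
    by (intro cremona_surface_proj_equiv torus_equiv_imp_proj_equiv)
  then show "cremona_surface (std_points A) \<subseteq> cremona_surface (std_points (cofactors A))"
    using cremona_surface_cofactors_subset[OF nondegenerate_cofactors[OF assms]] by simp
qed (rule cremona_surface_cofactors_subset[OF assms])

section \<open>Association and the rank condition\<close>

text \<open>Association, or Gale duality, of two sextuples of points of the plane.\<close>

definition associated :: "(6 \<Rightarrow> complex^3) \<Rightarrow> (6 \<Rightarrow> complex^3) \<Rightarrow> bool" where
  "associated x y \<longleftrightarrow> (\<exists>c. (\<exists>i. c i \<noteq> 0) \<and> (\<forall>a b. (\<Sum>i\<in>UNIV. c i * (x i $ a * y i $ b)) = 0))"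

text \<open>The rows are to be counted with multiplicity: a repeated row makes the rank drop although the set
  of rows may be independent.\<close>

lemma rank_less_iff:
  fixes M :: "'a::field^'n^'m"
  shows "rank M < CARD('m) \<longleftrightarrow> (\<exists>c. (\<exists>i. c i \<noteq> 0) \<and> (\<Sum>i\<in>UNIV. c i *s M $ i) = 0)"
proof
  assume "\<exists>c. (\<exists>i. c i \<noteq> 0) \<and> (\<Sum>i\<in>UNIV. c i *s M $ i) = 0"
  then obtain c k where c: "c k \<noteq> 0" "(\<Sum>i\<in>UNIV. c i *s M $ i) = 0" by blast
  let ?S = "($) M ` (UNIV - {k})"
  have remove: "(\<Sum>i\<in>UNIV. c i *s M $ i) = c k *s M $ k + (\<Sum>i\<in>UNIV - {k}. c i *s M $ i)"
    by (rule sum.remove) auto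
  have "c k *s M $ k = - (\<Sum>i\<in>UNIV - {k}. c i *s M $ i)"
    unfolding eq_neg_iff_add_eq_0 by (rule trans[OF sym[OF remove] c(2)])
  moreover have "(\<Sum>i\<in>UNIV - {k}. c i *s M $ i) \<in> vec.span ?S"
    by (intro vec.span_sum vec.span_scale vec.span_base) auto
  ultimately have "c k *s M $ k \<in> vec.span ?S" by (simp add: vec.span_neg)
  then have "(1 / c k) *s (c k *s M $ k) \<in> vec.span ?S" by (rule vec.span_scale)
  then have k: "M $ k \<in> vec.span ?S" using c(1) by (simp add: vector_smult_assoc)
  have "M $ i \<in> vec.span ?S" for i
    using k by (cases "i = k") (auto intro: vec.span_base)
  then have "rows M \<subseteq> vec.span ?S" by (auto simp: rows_def row_def vec_nth_inverse)
  then have "vec.dim (rows M) \<le> card ?S" by (rule vec.dim_le_card) simp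
  also have "\<dots> \<le> card (UNIV - {k})" by (rule card_image_le) simp
  also have "\<dots> < CARD('m)" by (simp add: card_Diff_singleton)
  finally show "rank M < CARD('m)" by (simp add: row_rank_def_gen)
next
  assume less: "rank M < CARD('m)"
  show "\<exists>c. (\<exists>i. c i \<noteq> 0) \<and> (\<Sum>i\<in>UNIV. c i *s M $ i) = 0"
  proof (rule ccontr)
    assume "\<not> ?thesis"
    then have none: "c i = 0" if "(\<Sum>i\<in>UNIV. c i *s M $ i) = 0" for c i
      using that by blast
    have rows: "rows M = range (($) M)" by (auto simp: rows_def row_def vec_nth_inverse)
    have inj: "inj (($) M)"
    proof (rule injI, rule ccontr)
      fix i j assume ij: "M $ i = M $ j" "i \<noteq> j"
      let ?c = "\<lambda>k. (if k = i then 1 else 0) - (if k = j then 1 else 0) :: 'a"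
      have "?c k *s M $ k = (if k = i then M $ k else 0) - (if k = j then M $ k else 0)" for k
        using ij(2) by (auto simp: vec_eq_iff)
      then have sum: "(\<Sum>k\<in>UNIV. ?c k *s M $ k) = 0"
        using ij(1) by (simp add: sum_subtractf)
      show False using none[OF sum, of i] ij(2) by simp
    qed
    have "vec.independent (rows M)"
    proof (rule ccontr)
      assume "\<not> vec.independent (rows M)"
      then obtain u where u: "\<exists>v\<in>rows M. u v \<noteq> 0" "(\<Sum>v\<in>rows M. u v *s v) = 0"
        unfolding rows by (subst (asm) vec.dependent_finite) auto
      have sum: "(\<Sum>i\<in>UNIV. u (M $ i) *s M $ i) = 0"
        using u(2) unfolding rows by (simp add: sum.reindex[OF inj])
      show False using none[OF sum] u(1) unfolding rows by blast
    qed
    then have "rank M = card (rows M)" by (simp add: row_rank_def_gen vec.dim_eq_card_independent)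
    then show False using less by (simp add: rows card_image[OF inj])
  qed
qed

lemma rank_Z_matrix: "rank (Z_matrix x y) < 6 \<longleftrightarrow> associated x y"
proof -
  have "(\<Sum>i\<in>UNIV. c i *s Z_matrix x y $ i) = 0 \<longleftrightarrow>
      (\<forall>a b. (\<Sum>i\<in>UNIV. c i * (x i $ a * y i $ b)) = 0)" for c
    by (auto simp: vec_eq_iff Z_matrix_def kronecker_def)
  then show ?thesis using rank_less_iff[of "Z_matrix x y"] by (simp add: associated_def)
qed

lemma associated_proj_equiv:
  assumes "associated x y" "proj_equiv x x'" "proj_equiv y y'"
  shows "associated x' y'"
proof -
  obtain H :: "complex^3^3" and s where H: "\<And>i. s i \<noteq> 0" "\<And>i. H *v x i = s i *s x' i"
    using assms(2) unfolding proj_equiv_def same_point_def by metis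
  obtain K :: "complex^3^3" and t where K: "\<And>i. t i \<noteq> 0" "\<And>i. K *v y i = t i *s y' i"
    using assms(3) unfolding proj_equiv_def same_point_def by metis
  obtain c k where c: "c k \<noteq> 0" "\<And>a b. (\<Sum>i\<in>UNIV. c i * (x i $ a * y i $ b)) = 0"
    using assms(1) unfolding associated_def by blast
  let ?c = "\<lambda>i. c i * (s i * t i)"
  have "(\<Sum>i\<in>UNIV. ?c i * (x' i $ a * y' i $ b)) = 0" for a b
  proof -
    have "?c i * (x' i $ a * y' i $ b) =
        (\<Sum>p\<in>UNIV. \<Sum>q\<in>UNIV. H $ a $ p * K $ b $ q * (c i * (x i $ p * y i $ q)))" for i
    proof -
      have "?c i * (x' i $ a * y' i $ b) = c i * ((H *v x i) $ a * (K *v y i) $ b)"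
        unfolding H(2) K(2) by simp
      also have "\<dots> = (\<Sum>p\<in>UNIV. \<Sum>q\<in>UNIV. H $ a $ p * K $ b $ q * (c i * (x i $ p * y i $ q)))"
        by (simp add: matrix_vector_mult_def sum_3 distrib_left distrib_right mult_ac)
      finally show ?thesis .
    qed
    then have "(\<Sum>i\<in>UNIV. ?c i * (x' i $ a * y' i $ b)) =
        (\<Sum>i\<in>UNIV. \<Sum>p\<in>UNIV. \<Sum>q\<in>UNIV. H $ a $ p * K $ b $ q * (c i * (x i $ p * y i $ q)))"
      by (rule sum.cong[OF refl])
    also have "\<dots> = (\<Sum>p\<in>UNIV. \<Sum>q\<in>UNIV. H $ a $ p * K $ b $ q * (\<Sum>i\<in>UNIV. c i * (x i $ p * y i $ q)))"
      unfolding sum_distrib_left by (subst sum.swap, rule sum.cong[OF refl], rule sum.swap)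
    finally show ?thesis by (simp add: c(2))
  qed
  moreover have "?c k \<noteq> 0" using c(1) H(1) K(1) by simp
  then have "\<exists>i. ?c i \<noteq> 0" by (rule exI)
  ultimately show ?thesis unfolding associated_def by (intro exI[of _ ?c] conjI allI)
qed

lemma sum_std_points:
  "(\<Sum>i\<in>UNIV. c i * (std_points A i $ a * std_points B i $ b)) =
     (if a = b then (vector [c 1, c 2, c 3] :: complex^3) $ a else 0) +
     (\<Sum>j\<in>UNIV. (vector [c 4, c 5, c 6] :: complex^3) $ j * (A $ a $ j * B $ b $ j))"
  using exhaust_3[of a] exhaust_3[of b]
  by (elim disjE) (simp_all add: sum_6 sum_3 axis_def column_def)

text \<open>For \<open>x = (I | A)\<close> and \<open>y = (I | B)\<close> the condition says that the matrix \<open>A D B\<^sup>T\<close> is minus a diagonal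
  matrix \<open>E\<close>, where \<open>D\<close> and \<open>E\<close> contain the coefficients. As the transposed inverse of \<open>B\<close> is its matrix
  of cofactors divided by its determinant, \<open>A\<close> is obtained from the cofactors by rescaling rows and
  columns. Since no entry of \<open>A\<close> or of the cofactors vanishes, no coefficient can vanish.\<close>

lemma associated_std_points:
  assumes A: "nondegenerate A" and B: "nondegenerate B"
  shows "associated (std_points A) (std_points B) \<longleftrightarrow> torus_equiv A (cofactors B)"
proof
  let ?C = "cofactors B"
  assume "torus_equiv A ?C"
  then obtain h k where hk: "\<And>i. h i \<noteq> 0" "\<And>i. k i \<noteq> 0" "\<And>i j. A $ i $ j = h i * k j * ?C $ i $ j"
    unfolding torus_equiv_def by blast
  define c where "c = (\<lambda>i. (vector [- h 1 * det B, - h 2 * det B, - h 3 * det B, 1 / k 1, 1 / k 2, 1 / k 3] :: complex^6) $ i)"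
  have "\<forall>a b. (\<Sum>i\<in>UNIV. c i * (std_points A i $ a * std_points B i $ b)) = 0"
  proof (intro allI)
    fix a b
    have e: "(vector [c 1, c 2, c 3] :: complex^3) $ a = - h a * det B"
      using exhaust_3[of a] by (elim disjE) (simp_all add: c_def)
    have d: "(vector [c 4, c 5, c 6] :: complex^3) $ j = 1 / k j" for j
      using exhaust_3[of j] by (elim disjE) (simp_all add: c_def)
    have "(\<Sum>j\<in>UNIV. 1 / k j * (A $ a $ j * B $ b $ j)) = h a * (\<Sum>j\<in>UNIV. ?C $ a $ j * B $ b $ j)"
      unfolding sum_distrib_left by (intro sum.cong refl) (simp add: hk)
    then show "(\<Sum>i\<in>UNIV. c i * (std_points A i $ a * std_points B i $ b)) = 0"
      unfolding sum_std_points e d cofactors_orthogonal by simp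
  qed
  moreover have "c 4 \<noteq> 0" using hk(2) by (simp add: c_def)
  ultimately show "associated (std_points A) (std_points B)" unfolding associated_def by blast
next
  let ?C = "cofactors B"
  assume "associated (std_points A) (std_points B)"
  then obtain c where c: "\<exists>i. c i \<noteq> 0" "\<And>a b. (\<Sum>i\<in>UNIV. c i * (std_points A i $ a * std_points B i $ b)) = 0"
    unfolding associated_def by blast
  define e :: "complex^3" where "e = vector [c 1, c 2, c 3]"
  define d :: "complex^3" where "d = vector [c 4, c 5, c 6]"
  have nz: "A $ i $ j \<noteq> 0" "?C $ i $ j \<noteq> 0" "det B \<noteq> 0" for i j
    using A B by (auto simp: nondegenerate_def)
  have orth: "(\<Sum>j\<in>UNIV. d $ j * A $ a $ j * B $ b $ j) = - (if a = b then e $ a else 0)" for a b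
  proof -
    have "(if a = b then e $ a else 0) + (\<Sum>j\<in>UNIV. d $ j * (A $ a $ j * B $ b $ j)) = 0"
      using c(2)[of a b] unfolding sum_std_points d_def[symmetric] e_def[symmetric] .
    then show ?thesis by (simp add: eq_neg_iff_add_eq_0 mult.assoc add.commute)
  qed
  have key: "d $ j * A $ a $ j * det B = - e $ a * ?C $ a $ j" for a j
  proof -
    have "d $ j * A $ a $ j * det B = (\<Sum>k\<in>UNIV. d $ k * A $ a $ k * (if j = k then det B else 0))"
      by (simp add: if_distrib cong: if_cong)
    also have "\<dots> = (\<Sum>k\<in>UNIV. \<Sum>b\<in>UNIV. d $ k * A $ a $ k * (?C $ b $ j * B $ b $ k))"
      unfolding cofactors_orthogonal'[of B j, symmetric] sum_distrib_left ..
    also have "\<dots> = (\<Sum>b\<in>UNIV. ?C $ b $ j * (\<Sum>k\<in>UNIV. d $ k * A $ a $ k * B $ b $ k))"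
      unfolding sum_distrib_left by (subst sum.swap) (simp add: mult_ac)
    also have "\<dots> = - e $ a * ?C $ a $ j"
      unfolding orth by (simp add: if_distrib cong: if_cong)
    finally show ?thesis .
  qed
  have iff: "d $ j = 0 \<longleftrightarrow> e $ a = 0" for a j
    using key[of j a] nz(1)[of a j] nz(2)[of a j] nz(3) by (metis mult_eq_0_iff neg_equal_0_iff_equal)
  have "d $ j \<noteq> 0" "e $ a \<noteq> 0" for a j
  proof -
    have "\<not> (e $ 1 = 0 \<and> e $ 2 = 0 \<and> e $ 3 = 0 \<and> d $ 1 = 0 \<and> d $ 2 = 0 \<and> d $ 3 = 0)"
      using c(1) exhaust_6 by (simp add: e_def d_def) metis
    then show "d $ j \<noteq> 0" "e $ a \<noteq> 0" using iff by metis+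
  qed
  moreover have "A $ a $ j = (- e $ a / det B) * (1 / d $ j) * ?C $ a $ j" for a j
    using key[of j a] calculation(1) nz(3) by (simp add: field_simps)
  ultimately show "torus_equiv A ?C"
    unfolding torus_equiv_def using nz(3)
    by (intro exI[of _ "\<lambda>a. - e $ a / det B"] exI[of _ "\<lambda>j. 1 / d $ j"]) simp
qed

section \<open>Equality of Cremona hexahedral surfaces\<close>

theorem theorem6p22:
  fixes x y :: "6 \<Rightarrow> complex^3"
  assumes "\<And>i. x i \<noteq> 0" and "\<And>i. y i \<noteq> 0"
    and "general_position x" and "general_position y"
  shows "cremona_surface x = cremona_surface y \<longleftrightarrow>
    (\<exists>H :: complex^3^3. invertible H \<and> (\<forall>i. same_point (H *v x i) (y i))) \<or>
    rank (Z_matrix x y) < 6"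
proof -
  obtain A where A: "nondegenerate A" "proj_equiv x (std_points A)"
    using assms(3) general_position_no_three_collinear normal_form by blast
  obtain B where B: "nondegenerate B" "proj_equiv y (std_points B)"
    using assms(4) general_position_no_three_collinear normal_form by blast
  note SA = cremona_surface_proj_equiv[OF A(2)] and SB = cremona_surface_proj_equiv[OF B(2)]
  have "cremona_surface x = cremona_surface y \<longleftrightarrow> proj_equiv x y \<or> associated x y"
  proof
    assume "cremona_surface x = cremona_surface y"
    then have "cremona_surface (std_points A) = cremona_surface (std_points B)" by (simp add: SA SB)
    from relation_coefficients[OF B(1) cremona_surface_eq_imp_relation[OF this]]
    obtain l c where "\<And>i. diag_products A $ i = l * diag_products B $ i + c"
      by blast
    from torus_equiv_dichotomy[OF A(1) B(1) this] show "proj_equiv x y \<or> associated x y"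
    proof
      assume "torus_equiv A B"
      then show ?thesis
        using A(2) B(2) torus_equiv_imp_proj_equiv proj_equiv_sym proj_equiv_trans by blast
    next
      assume "torus_equiv A (cofactors B)"
      then have "associated (std_points A) (std_points B)" using associated_std_points[OF A(1) B(1)] by blast
      then show ?thesis using A(2) B(2) associated_proj_equiv proj_equiv_sym by blast
    qed
  next
    assume "proj_equiv x y \<or> associated x y"
    then show "cremona_surface x = cremona_surface y"
    proof
      assume "associated x y"
      then have "associated (std_points A) (std_points B)" using A(2) B(2) associated_proj_equiv by blast
      then have "torus_equiv A (cofactors B)" using associated_std_points[OF A(1) B(1)] by blast
      then show ?thesis
        unfolding SA SB using cremona_surface_proj_equiv[OF torus_equiv_imp_proj_equiv] 
          cremona_surface_cofactors[OF B(1)] by blast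
    qed (rule cremona_surface_proj_equiv)
  qed
  then show ?thesis unfolding rank_Z_matrix proj_equiv_def .
qed

end
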